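(* For any $2n\times 2n$ indefinite orthogonal matrix $O\in\mathrm{O}(n,n)$, there exist two $n\times n$ real orthogonal matrices $O_1,O_2$, an $n\times n$ complex orthogonal matrix $V$, and $n$ unique (up to order and signs) real numbers $\theta_1,\dots,\theta_n$ such that $$O=\begin{bmatrix} O_1 & 0 \\ 0 & O_2 \end{bmatrix}\begin{bmatrix} Ch & Sh \\ Sh & Ch \end{bmatrix}[V]_{\mathbb{R}}.$$
   Context: $\mathrm{O}(n,n)=\{G\in\mathbb{R}^{2n\times2n}:G^TI_{n,n}G=I_{n,n}\}$ with $I_{n,n}=\operatorname{diag}(I_n,-I_n)$. A complex orthogonal matrix is $V\in\mathbb{C}^{n\times n}$ with $V^TV=I_n$ (ordinary transpose). The realify map is $$[X]_{\mathbb{R}}=\begin{bmatrix} \operatorname{Re}X & \operatorname{Im}X \\ -\operatorname{Im}X & \operatorname{Re}X \end{bmatrix}.$$ $Ch=\operatorname{diag}(\cosh\theta_1,\dots,\cosh\theta_n)$ and $Sh=\operatorname{diag}(\sinh\theta_1,\dots,\sinh\theta_n)$. *)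

theory Defs
  imports "HOL-Analysis.Analysis"
begin

text \<open>A matrix with 2n rows and 2n columns, n = \<open>CARD('n)\<close>, is indexed by \<open>'n + 'n\<close>:
  \<open>Inl\<close> is the first block of n indices and \<open>Inr\<close> the second.\<close>

definition block_matrix ::
  "'a ^ 'n ^ 'n \<Rightarrow> 'a ^ 'n ^ 'n \<Rightarrow> 'a ^ 'n ^ 'n \<Rightarrow> 'a ^ 'n ^ 'n
    \<Rightarrow> 'a ^ ('n::finite + 'n) ^ ('n + 'n)" where
  "block_matrix A B C D = (\<chi> i j.
     case i of
       Inl r \<Rightarrow> (case j of Inl c \<Rightarrow> A $ r $ c | Inr c \<Rightarrow> B $ r $ c)
     | Inr r \<Rightarrow> (case j of Inl c \<Rightarrow> C $ r $ c | Inr c \<Rightarrow> D $ r $ c))"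

definition diagonal_matrix :: "('n::finite \<Rightarrow> real) \<Rightarrow> real ^ 'n ^ 'n" where
  "diagonal_matrix d = (\<chi> i j. if i = j then d i else 0)"

definition signature_matrix :: "real ^ ('n::finite + 'n) ^ ('n + 'n)" where
  "signature_matrix = block_matrix (mat 1) 0 0 (- mat 1)"

definition indefinite_orthogonal_group :: "(real ^ ('n::finite + 'n) ^ ('n + 'n)) set" where
  "indefinite_orthogonal_group =
     {G. transpose G ** signature_matrix ** G = signature_matrix}"

text \<open>The transpose is not conjugated, so this is not unitarity.\<close>

definition complex_orthogonal_matrix :: "complex ^ 'n ^ 'n::finite \<Rightarrow> bool" where
  "complex_orthogonal_matrix V \<longleftrightarrow> transpose V ** V = mat 1"

definition realify :: "complex ^ 'n ^ 'n::finite \<Rightarrow> real ^ ('n + 'n) ^ ('n + 'n)" where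
  "realify X = block_matrix (map_matrix Re X) (map_matrix Im X)
                            (- map_matrix Im X) (map_matrix Re X)"

definition hyperbolic_matrix :: "('n::finite \<Rightarrow> real) \<Rightarrow> real ^ ('n + 'n) ^ ('n + 'n)" where
  "hyperbolic_matrix \<theta> =
     (let Ch = diagonal_matrix (\<lambda>i. cosh (\<theta> i)); Sh = diagonal_matrix (\<lambda>i. sinh (\<theta> i))
      in block_matrix Ch Sh Sh Ch)"

definition is_factorization ::
  "real ^ ('n::finite + 'n) ^ ('n + 'n) \<Rightarrow> real ^ 'n ^ 'n \<Rightarrow> real ^ 'n ^ 'n
    \<Rightarrow> ('n \<Rightarrow> real) \<Rightarrow> complex ^ 'n ^ 'n \<Rightarrow> bool" where
  "is_factorization G O1 O2 \<theta> V \<longleftrightarrow>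
     orthogonal_matrix O1 \<and> orthogonal_matrix O2 \<and> complex_orthogonal_matrix V \<and>
     G = block_matrix O1 0 0 O2 ** hyperbolic_matrix \<theta> ** realify V"

definition equal_up_to_order_and_signs :: "('n::finite \<Rightarrow> real) \<Rightarrow> ('n \<Rightarrow> real) \<Rightarrow> bool" where
  "equal_up_to_order_and_signs \<theta> \<phi> \<longleftrightarrow>
     (\<exists>p s. p permutes UNIV \<and> (\<forall>i. s i \<in> {1, -1}) \<and> (\<forall>i. \<phi> i = s i * \<theta> (p i)))"

end

theory Submission
  imports Defs
begin

text \<open>Write $E$ for the matrix exchanging the two blocks and $C$ for the signature matrix.
  Realified complex orthogonal matrices $X$ are exactly the elements of $O(n,n)$ with
  $X E X^T = E$. Hence $N = G E G^T$ does not depend on $V$, and a direct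
  computation shows that its upper left block is $O_1 \, \mathrm{diag}(\sinh 2\theta_i) \, O_1^T$,
  so the numbers $\theta_i$ are determined up to order as halves of the inverse hyperbolic sines of its
  eigenvalues. Conversely, $N$ is symmetric with $N C N = - C$. Diagonalising its upper left block
  by the spectral theorem determines $O_1$ and $\theta$, the upper right block then yields $O_2$, and the
  remaining factor of $G$ preserves both $C$ and $E$, so it is realified complex orthogonal.\<close>

section \<open>The spectral theorem for self-adjoint maps\<close>

text \<open>A maximiser of the quadratic form \<open>x \<bullet> f x\<close> on the unit sphere of
  \<open>S\<close> is an eigenvector, and its orthogonal complement inside \<open>S\<close> is again
  invariant. The claim is made for all invariant subspaces so that induction on the dimension
  applies to that complement.\<close>

lemma selfadjoint_orthonormal_eigenbasis:
  fixes f :: "'a::euclidean_space \<Rightarrow> 'a"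
  assumes lin: "linear f" and sa: "\<And>x y. f x \<bullet> y = x \<bullet> f y"
    and "subspace S" "f ` S \<subseteq> S"
  shows "\<exists>B. pairwise orthogonal B \<and> span B = S \<and> (\<forall>b\<in>B. norm b = 1 \<and> (\<exists>c. f b = c *\<^sub>R b))"
  using assms(3,4)
proof (induction "dim S" arbitrary: S rule: less_induct)
  case less
  note S = \<open>subspace S\<close> and inv = \<open>f ` S \<subseteq> S\<close>
  show ?case
  proof (cases "S = {0}")
    case True
    then show ?thesis by (intro exI[of _ "{}"]) auto
  next
    case False
    then obtain x where x: "x \<in> S" "x \<noteq> 0"
      using S subspace_0 by blast
    define U where "U = S \<inter> sphere 0 1"
    have "x /\<^sub>R norm x \<in> U"
      using x S by (auto simp: U_def subspace_scale)
    moreover have "compact U"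
      unfolding U_def using closed_subspace[OF S] by (intro closed_Int_compact) auto
    moreover have "continuous_on U (\<lambda>x. x \<bullet> f x)"
      using lin by (intro continuous_intros linear_continuous_on) (simp add: linear_conv_bounded_linear)
    ultimately obtain v where v: "v \<in> U" "\<And>y. y \<in> U \<Longrightarrow> y \<bullet> f y \<le> v \<bullet> f v"
      using continuous_attains_sup[of U "\<lambda>x. x \<bullet> f x"] by blast
    define c where "c = v \<bullet> f v"
    have vS: "v \<in> S" and nv: "norm v = 1" using v by (auto simp: U_def)
    have vv: "v \<bullet> v = 1" using nv by (simp add: norm_eq_1)
    \<comment> \<open>By homogeneity, maximality on the unit sphere becomes a bound on all of
      \<open>S\<close>.\<close>
    have le: "y \<bullet> f y \<le> c * (y \<bullet> y)" if "y \<in> S" for y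
    proof (cases "y = 0")
      case False
      have "y /\<^sub>R norm y \<in> U" using that False S by (auto simp: U_def subspace_scale)
      from v(2)[OF this] have "(y \<bullet> f y) / (norm y)\<^sup>2 \<le> c"
        by (simp add: linear_cmul[OF lin] c_def power2_eq_square field_simps)
      then show ?thesis using False by (simp add: field_simps power2_norm_eq_inner)
    qed (simp add: linear_0[OF lin])
    \<comment> \<open>The residual of the eigenvalue equation. It lies in \<open>S\<close>, so
      \<open>v\<close> may be perturbed in this direction.\<close>
    define u where "u = f v - c *\<^sub>R v"
    have uS: "u \<in> S" unfolding u_def using inv vS S by (auto intro!: subspace_diff subspace_scale)
    \<comment> \<open>This is the bound at \<open>v + t *\<^sub>R u\<close>: the constant terms and
      those with \<open>u \<bullet> v\<close> cancel, leaving \<open>2 * t * (u \<bullet> u)\<close>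
      as the first-order term.\<close>
    have ineq: "2 * t * (u \<bullet> u) \<le> t\<^sup>2 * (c * (u \<bullet> u) - u \<bullet> f u)" for t
    proof -
      have "v + t *\<^sub>R u \<in> S" using vS uS S by (auto intro!: subspace_add subspace_scale)
      note le[OF this]
      moreover have vfu: "v \<bullet> f u = u \<bullet> f v" and vu: "v \<bullet> u = u \<bullet> v"
        by (metis sa inner_commute) (rule inner_commute)
      ultimately have "c + 2 * t * (u \<bullet> f v) + t\<^sup>2 * (u \<bullet> f u) \<le> c * (1 + 2 * t * (u \<bullet> v) + t\<^sup>2 * (u \<bullet> u))"
        by (simp add: linear_add[OF lin] linear_cmul[OF lin] inner_add_left inner_add_right
            vv vfu vu distrib_left power2_eq_square mult.assoc flip: c_def)
      moreover have "u \<bullet> f v = u \<bullet> u + c * (u \<bullet> v)"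
        by (subst (3) u_def) (simp add: inner_diff_right)
      ultimately show ?thesis by (simp only:) (simp add: algebra_simps)
    qed
    \<comment> \<open>otherwise the inequality fails for small positive \<open>t\<close>\<close>
    have "u \<bullet> u = 0"
    proof (rule ccontr)
      assume nz: "u \<bullet> u \<noteq> 0"
      define a where "a = u \<bullet> u"
      define q where "q = c * (u \<bullet> u) - u \<bullet> f u"
      have a: "a > 0" using nz unfolding a_def by (simp add: inner_gt_zero_iff)
      \<comment> \<open>With this \<open>t\<close> the right-hand side \<open>t * q\<close> is at
        most \<open>a\<close>, although it should be at least \<open>2 * a\<close>. The summand 1
        keeps the denominator positive when \<open>q = 0\<close>.\<close>
      define t where "t = a / (\<bar>q\<bar> + 1)"
      have t: "t > 0" using a by (simp add: t_def)
      have "2 * t * a \<le> t\<^sup>2 * q" using ineq[of t] by (simp add: a_def q_def)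
      then have "2 * a \<le> t * q" using t by (simp add: power2_eq_square)
      also have "\<dots> \<le> t * (\<bar>q\<bar> + 1)" using t by (intro mult_left_mono) auto
      also have "\<dots> = a" by (simp add: t_def)
      finally show False using a by simp
    qed
    then have fv: "f v = c *\<^sub>R v" by (simp add: u_def)
    define T where "T = S \<inter> {x. v \<bullet> x = 0}"
    have T: "subspace T" unfolding T_def using S subspace_hyperplane by (rule subspace_inter)
    have "v \<notin> T" using vv by (simp add: T_def)
    then have "T \<subset> S" using vS unfolding T_def by blast
    then have "dim T < dim S"
      using S T by (intro dim_psubset) (simp add: span_eq_iff[THEN iffD2])
    \<comment> \<open>For \<open>x\<close> in \<open>T\<close>, self-adjointness gives
      \<open>v \<bullet> f x = f v \<bullet> x = c * (v \<bullet> x) = 0\<close>.\<close>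
    moreover have "f ` T \<subseteq> T"
      using inv by (auto simp: T_def sa[symmetric] fv)
    ultimately obtain B where B: "pairwise orthogonal B" "span B = T"
      "\<forall>b\<in>B. norm b = 1 \<and> (\<exists>c. f b = c *\<^sub>R b)"
      using less.hyps[of T] T by blast
    have BT: "b \<in> T" if "b \<in> B" for b using B(2) that span_base by blast
    have "span (insert v B) = S"
    proof
      show "span (insert v B) \<subseteq> S"
        using BT vS S by (intro span_minimal) (auto simp: T_def)
      show "S \<subseteq> span (insert v B)"
      proof
        fix x assume x: "x \<in> S"
        have "x - (v \<bullet> x) *\<^sub>R v \<in> span B"
          unfolding B(2) T_def using x vS S vv
          by (auto intro!: subspace_diff subspace_scale simp: inner_diff_right)
        then show "x \<in> span (insert v B)" unfolding span_insert by blast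
      qed
    qed
    moreover have "pairwise orthogonal (insert v B)"
      using B(1) BT by (auto simp: pairwise_insert orthogonal_def T_def inner_commute)
    ultimately show ?thesis
      using B(3) nv fv by (intro exI[of _ "insert v B"]) auto
  qed
qed

section \<open>Diagonal matrices and orthogonal diagonalisation\<close>

lemma transpose_diagonal_matrix [simp]: "transpose (diagonal_matrix d) = diagonal_matrix d"
  by (simp add: transpose_def diagonal_matrix_def vec_eq_iff)

lemma diagonal_matrix_mult:
  "diagonal_matrix d ** diagonal_matrix e = diagonal_matrix (\<lambda>i. d i * e i)"
  by (auto simp: matrix_matrix_mult_def diagonal_matrix_def vec_eq_iff if_distrib
      cong: if_cong intro!: sum.neutral)

lemma diagonal_matrix_add:
  "diagonal_matrix d + diagonal_matrix e = diagonal_matrix (\<lambda>i. d i + e i)"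
  by (simp add: diagonal_matrix_def vec_eq_iff)

lemma diagonal_matrix_one: "diagonal_matrix (\<lambda>i. 1) = mat 1"
  by (simp add: diagonal_matrix_def mat_def vec_eq_iff)

lemma matrix_mult_diagonal_nth: "(A ** diagonal_matrix d) $ i $ j = A $ i $ j * d j"
  by (simp add: matrix_matrix_mult_def diagonal_matrix_def if_distrib cong: if_cong)

lemma diagonal_matrix_mult_nth: "(diagonal_matrix d ** A) $ i $ j = d i * A $ i $ j"
  by (simp add: matrix_matrix_mult_def diagonal_matrix_def if_distrib[where f="\<lambda>x. x * _"] cong: if_cong)

text \<open>The columns of \<open>P\<close> are an orthonormal eigenbasis, which has
  \<open>CARD('n)\<close> elements and can therefore be indexed by \<open>'n\<close>.\<close>

lemma symmetric_matrix_orthogonally_diagonalizable: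
  fixes A :: "real ^ 'n ^ 'n::finite"
  assumes "transpose A = A"
  obtains P d where "orthogonal_matrix P" "A = P ** diagonal_matrix d ** transpose P"
proof -
  have "(A *v x) \<bullet> y = x \<bullet> (A *v y)" for x y
    by (metis assms dot_lmul_matrix vector_transpose_matrix)
  then obtain B where B: "pairwise orthogonal B" "span B = UNIV"
      "\<And>b. b \<in> B \<Longrightarrow> norm b = 1" "\<forall>b\<in>B. \<exists>c. A *v b = c *\<^sub>R b"
    using selfadjoint_orthonormal_eigenbasis[of "(*v) A" UNIV] by auto
  have ind: "independent B"
    using B by (intro pairwise_orthogonal_independent) force+
  have "card B = CARD('n)"
    using dim_span_eq_card_independent[OF ind] B(2) by simp
  then obtain w where w: "bij_betw w (UNIV :: 'n set) B"
    using finite_same_card_bij[of "UNIV :: 'n set" B] independent_imp_finite[OF ind] by auto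
  from B(4) obtain c where c: "\<And>b. b \<in> B \<Longrightarrow> A *v b = c b *\<^sub>R b" by metis
  define P :: "real ^ 'n ^ 'n" where "P = (\<chi> i j. w j $ i)"
  have wB: "w j \<in> B" for j using w by (auto simp: bij_betw_def)
  have "w i \<bullet> w j = (if i = j then 1 else 0)" for i j
    using B(1) B(3)[OF wB] wB w
    by (auto simp: pairwise_def orthogonal_def bij_betw_def inj_eq norm_eq_1)
  then have "transpose P ** P = mat 1"
    by (simp add: P_def matrix_matrix_mult_def transpose_def mat_def vec_eq_iff inner_vec_def)
  then have P: "orthogonal_matrix P" by (simp add: orthogonal_matrix)
  have "(A ** P) $ i $ j = (P ** diagonal_matrix (\<lambda>j. c (w j))) $ i $ j" for i j
    using arg_cong[OF c[OF wB[of j]], of "\<lambda>x. x $ i"]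
    unfolding matrix_mult_diagonal_nth
    by (simp add: matrix_matrix_mult_def matrix_vector_mult_def P_def)
  then have "A ** P = P ** diagonal_matrix (\<lambda>j. c (w j))" by (simp add: vec_eq_iff)
  then have "A = P ** diagonal_matrix (\<lambda>j. c (w j)) ** transpose P"
    using P by (metis matrix_mul_assoc matrix_mul_rid orthogonal_matrix_def)
  with P show ?thesis using that by blast
qed

text \<open>The matrix \<open>R = transpose Q ** P\<close> intertwines the two diagonal matrices, so
  a nonzero entry \<open>R $ i $ j\<close> forces \<open>e i = d j\<close>. Choosing nonzero entries
  along a permutation matches the eigenvalues with their multiplicities, without characteristic
  polynomials.\<close>

lemma orthogonally_similar_diagonal_matrices:
  assumes P: "orthogonal_matrix P" and Q: "orthogonal_matrix Q"
    and eq: "P ** diagonal_matrix d ** transpose P = Q ** diagonal_matrix e ** transpose Q"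
  obtains p where "p permutes UNIV" "\<And>i. e i = d (p i)"
proof -
  define R where "R = transpose Q ** P"
  have "R ** diagonal_matrix d = transpose Q ** (P ** diagonal_matrix d ** transpose P) ** P"
    using P by (simp add: R_def orthogonal_matrix_def flip: matrix_mul_assoc)
  also have "\<dots> = diagonal_matrix e ** R"
    unfolding eq using Q by (simp add: R_def orthogonal_matrix_def matrix_mul_assoc)
  finally have comm: "R $ i $ j * d j = e i * R $ i $ j" for i j
    by (metis matrix_mult_diagonal_nth diagonal_matrix_mult_nth)
  have "orthogonal_matrix R"
    unfolding R_def using P Q by (simp add: orthogonal_matrix_mul orthogonal_matrix_transpose)
  then have "det R \<noteq> 0" using det_orthogonal_matrix by fastforce
  \<comment> \<open>some term of the Leibniz expansion is nonzero, and its permutation matches the entries\<close>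
  then obtain p where p: "p permutes UNIV" "(\<Prod>i\<in>UNIV. R $ i $ p i) \<noteq> 0"
    unfolding det_def by (metis (mono_tags, lifting) mem_Collect_eq mult_zero_right sum.neutral)
  then have "R $ i $ p i \<noteq> 0" for i by simp
  then have "e i = d (p i)" for i using comm[of i "p i"] by simp
  with p(1) show ?thesis using that by blast
qed

section \<open>Block matrices and elementary matrix algebra\<close>

lemma sum_UNIV_sum:
  fixes f :: "'a::finite + 'b::finite \<Rightarrow> 'c::comm_monoid_add"
  shows "sum f UNIV = (\<Sum>i\<in>UNIV. f (Inl i)) + (\<Sum>i\<in>UNIV. f (Inr i))"
  by (subst UNIV_Plus_UNIV[symmetric], subst sum.Plus) simp_all

lemma block_matrix_mult:
  fixes A B C D :: "'a::semiring_1 ^ 'n ^ 'n::finite"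
  shows "block_matrix A B C D ** block_matrix A' B' C' D' =
    block_matrix (A ** A' + B ** C') (A ** B' + B ** D') (C ** A' + D ** C') (C ** B' + D ** D')"
  by (auto simp: block_matrix_def matrix_matrix_mult_def vec_eq_iff sum_UNIV_sum split: sum.split)

lemma transpose_block_matrix:
  "transpose (block_matrix A B C D) =
    block_matrix (transpose A) (transpose C) (transpose B) (transpose D)"
  by (auto simp: block_matrix_def transpose_def vec_eq_iff split: sum.split)

lemma block_matrix_eq_iff:
  "block_matrix A B C D = block_matrix A' B' C' D' \<longleftrightarrow> A = A' \<and> B = B' \<and> C = C' \<and> D = D'"
  by (simp add: block_matrix_def vec_eq_iff split_sum_all) blast

lemma block_matrix_one: "block_matrix (mat 1) 0 0 (mat 1) = mat 1"
  by (auto simp: block_matrix_def mat_def vec_eq_iff split: sum.split)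

lemma block_matrix_cases:
  obtains A B C D where "M = block_matrix A B C D"
proof
  show "M = block_matrix (\<chi> i j. M $ Inl i $ Inl j) (\<chi> i j. M $ Inl i $ Inr j)
    (\<chi> i j. M $ Inr i $ Inl j) (\<chi> i j. M $ Inr i $ Inr j)"
    by (auto simp: block_matrix_def vec_eq_iff split: sum.split)
qed


lemma matrix_mult_minus_left [simp]: "(- A) ** B = - (A ** B :: 'a::ring_1 ^ 'n ^ 'm)"
  by (simp add: matrix_matrix_mult_def vec_eq_iff sum_negf)

lemma matrix_mult_minus_right [simp]: "A ** (- B) = - (A ** B :: 'a::ring_1 ^ 'n ^ 'm)"
  by (simp add: matrix_matrix_mult_def vec_eq_iff sum_negf)

lemma matrix_mult_zero_left [simp]: "0 ** B = (0 :: 'a::semiring_1 ^ 'n ^ 'm)"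
  by (simp add: matrix_matrix_mult_def vec_eq_iff)

lemma matrix_mult_zero_right [simp]: "A ** 0 = (0 :: 'a::semiring_1 ^ 'n ^ 'm)"
  by (simp add: matrix_matrix_mult_def vec_eq_iff)

lemma matrix_mult_add_left: "(A + B) ** C = A ** C + (B ** C :: 'a::semiring_1 ^ 'n ^ 'm)"
  by (simp add: matrix_matrix_mult_def vec_eq_iff sum.distrib algebra_simps)

text \<open>Cancels inverse factors at the head of a product associated to the right, where the
  hypothesis alone would not match.\<close>

lemma matrix_mult_cancel_left:
  "A ** B = mat 1 \<Longrightarrow> A ** (B ** X) = (X :: 'a::semiring_1 ^ 'n ^ 'm)"
  by (simp add: matrix_mul_assoc)

lemma transpose_minus: "transpose (- A) = - transpose (A :: 'a::ab_group_add ^ 'n ^ 'm)"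
  by (simp add: transpose_def vec_eq_iff)

lemma transpose_zero [simp]: "transpose 0 = 0"
  by (simp add: transpose_def vec_eq_iff)

lemma minus_block_matrix: "- block_matrix A B C D = block_matrix (- A) (- B) (- C) (- D)"
  by (auto simp: block_matrix_def vec_eq_iff split: sum.split)

section \<open>The signature form, the exchange form and complex orthogonal matrices\<close>

definition exchange_matrix :: "real ^ ('n::finite + 'n) ^ ('n + 'n)" where
  "exchange_matrix = block_matrix 0 (mat 1) (mat 1) 0"

lemma signature_matrix_mult_self: "signature_matrix ** signature_matrix = mat 1"
  by (simp add: signature_matrix_def block_matrix_mult flip: block_matrix_one)

lemma transpose_signature_matrix [simp]: "transpose signature_matrix = signature_matrix"
  by (simp add: signature_matrix_def transpose_block_matrix transpose_minus transpose_mat)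

lemma transpose_exchange_matrix [simp]: "transpose exchange_matrix = exchange_matrix"
  by (simp add: exchange_matrix_def transpose_block_matrix transpose_mat)

lemma exchange_signature_exchange:
  "exchange_matrix ** signature_matrix ** exchange_matrix = - signature_matrix"
  by (simp add: exchange_matrix_def signature_matrix_def block_matrix_mult minus_block_matrix)

text \<open>The defining equation makes
  \<open>signature_matrix ** transpose G ** signature_matrix\<close> a left inverse of the square
  matrix \<open>G\<close>, hence a right inverse. Thus $O(n,n)$ is closed under
  transposition.\<close>

lemma indefinite_orthogonal_mult_signature_transpose:
  assumes "G \<in> indefinite_orthogonal_group"
  shows "G ** signature_matrix ** transpose G = signature_matrix"
proof -
  have "(signature_matrix ** transpose G ** signature_matrix) ** G = mat 1"
    using assms by (simp add: indefinite_orthogonal_group_def signature_matrix_mult_self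
        flip: matrix_mul_assoc)
  then have "G ** (signature_matrix ** transpose G ** signature_matrix) = mat 1"
    by (simp add: matrix_left_right_inverse)
  then have "G ** signature_matrix ** transpose G ** (signature_matrix ** signature_matrix)
      = signature_matrix"
    by (metis matrix_mul_assoc matrix_mul_lid)
  then show ?thesis by (simp add: signature_matrix_mult_self)
qed

text \<open>The off-diagonal blocks of the left-hand side are the real part of
  \<open>V ** transpose V\<close>, and the diagonal blocks are plus and minus its imaginary
  part.\<close>

lemma complex_orthogonal_realify_exchange:
  assumes "complex_orthogonal_matrix V"
  shows "realify V ** exchange_matrix ** transpose (realify V) = exchange_matrix"
proof -
  define A B where "A = map_matrix Re V" and "B = map_matrix Im V"
  have "V ** transpose V = mat 1"
    using assms by (simp add: complex_orthogonal_matrix_def matrix_left_right_inverse)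
  then have eq: "(V ** transpose V) $ i $ j = mat 1 $ i $ j" for i j by simp
  have re: "A ** transpose A - B ** transpose B = mat 1"
    using eq[THEN arg_cong, of Re]
    by (simp add: vec_eq_iff A_def B_def matrix_matrix_mult_def transpose_def mat_def
        sum_subtractf if_distrib cong: if_cong)
  have im: "A ** transpose B + B ** transpose A = 0"
    using eq[THEN arg_cong, of Im]
    by (simp add: vec_eq_iff A_def B_def matrix_matrix_mult_def transpose_def mat_def
        sum.distrib if_distrib cong: if_cong)
  show ?thesis
    using re im minus_unique[OF im]
    by (simp add: realify_def exchange_matrix_def block_matrix_mult transpose_block_matrix
        transpose_minus block_matrix_eq_iff algebra_simps flip: A_def B_def)
qed

text \<open>Up to sign, the product of the exchange and signature matrices is the realified imaginary
  unit, so the second hypothesis is complex linearity.\<close>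

lemma indefinite_orthogonal_realifyE:
  assumes "X \<in> indefinite_orthogonal_group"
    and "X ** (exchange_matrix ** signature_matrix) = (exchange_matrix ** signature_matrix) ** X"
  obtains V where "complex_orthogonal_matrix V" "X = realify V"
proof -
  obtain A B C D where X: "X = block_matrix A B C D" by (rule block_matrix_cases)
  \<comment> \<open>Comparing blocks in the commutation relation yields exactly the shape of a
    realified matrix.\<close>
  have "block_matrix B (- A) D (- C) = block_matrix (- C) (- D) A B"
    using assms(2) by (simp add: X exchange_matrix_def signature_matrix_def block_matrix_mult)
  then have CD: "C = - B" "D = A"
    unfolding block_matrix_eq_iff by (metis minus_minus)+
  define V where "V = (\<chi> i j. Complex (A $ i $ j) (B $ i $ j))"
  have "map_matrix Re V = A" "map_matrix Im V = B"
    by (simp_all add: V_def vec_eq_iff)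
  then have "X = realify V" by (simp add: realify_def X CD)
  \<comment> \<open>The blocks are, up to sign, the real and imaginary parts of
    \<open>transpose V ** V\<close>.\<close>
  have "block_matrix (transpose A ** A - transpose B ** B) (transpose A ** B + transpose B ** A)
      (transpose B ** A + transpose A ** B) (transpose B ** B - transpose A ** A)
      = block_matrix (mat 1) 0 0 (- mat 1)"
    using assms(1) by (simp add: indefinite_orthogonal_group_def X CD signature_matrix_def
        block_matrix_mult transpose_block_matrix transpose_minus)
  then have eqs: "transpose A ** A - transpose B ** B = mat 1"
      "transpose A ** B + transpose B ** A = 0"
    unfolding block_matrix_eq_iff by blast+
  have "(transpose V ** V) $ i $ j = mat 1 $ i $ j" for i j
  proof (rule complex_eqI)
    show "Re ((transpose V ** V) $ i $ j) = Re (mat 1 $ i $ j)"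
      using arg_cong[OF eqs(1), of "\<lambda>M. M $ i $ j"]
      by (simp add: V_def matrix_matrix_mult_def transpose_def mat_def sum_subtractf)
    show "Im ((transpose V ** V) $ i $ j) = Im (mat 1 $ i $ j)"
      using arg_cong[OF eqs(2), of "\<lambda>M. M $ i $ j"]
      by (simp add: V_def matrix_matrix_mult_def transpose_def mat_def sum.distrib)
  qed
  then have "complex_orthogonal_matrix V"
    by (simp add: complex_orthogonal_matrix_def vec_eq_iff)
  with \<open>X = realify V\<close> show ?thesis using that by blast
qed

section \<open>The block diagonal and hyperbolic factors\<close>

text \<open>The double-angle formulas evaluate the product for the hyperbolic factor alone; the
  block diagonal factor then acts by congruence.\<close>

lemma block_diagonal_hyperbolic_exchange:
  fixes O1 O2 :: "real ^ 'n ^ 'n::finite" and \<theta> :: "'n \<Rightarrow> real"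
  defines "H \<equiv> block_matrix O1 0 0 O2 ** hyperbolic_matrix \<theta>"
  shows "H ** exchange_matrix ** transpose H =
    block_matrix (O1 ** diagonal_matrix (\<lambda>i. sinh (2 * \<theta> i)) ** transpose O1)
      (O1 ** diagonal_matrix (\<lambda>i. cosh (2 * \<theta> i)) ** transpose O2)
      (O2 ** diagonal_matrix (\<lambda>i. cosh (2 * \<theta> i)) ** transpose O1)
      (O2 ** diagonal_matrix (\<lambda>i. sinh (2 * \<theta> i)) ** transpose O2)"
proof -
  have double: "sinh (\<theta> i) * cosh (\<theta> i) + cosh (\<theta> i) * sinh (\<theta> i) = sinh (2 * \<theta> i)"
    "cosh (\<theta> i) * sinh (\<theta> i) + sinh (\<theta> i) * cosh (\<theta> i) = sinh (2 * \<theta> i)"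
    "sinh (\<theta> i) * sinh (\<theta> i) + cosh (\<theta> i) * cosh (\<theta> i) = cosh (2 * \<theta> i)"
    "cosh (\<theta> i) * cosh (\<theta> i) + sinh (\<theta> i) * sinh (\<theta> i) = cosh (2 * \<theta> i)" for i
    by (simp_all add: sinh_double cosh_double power2_eq_square)
  have hyp: "hyperbolic_matrix \<theta> ** exchange_matrix ** transpose (hyperbolic_matrix \<theta>) =
    block_matrix (diagonal_matrix (\<lambda>i. sinh (2 * \<theta> i))) (diagonal_matrix (\<lambda>i. cosh (2 * \<theta> i)))
      (diagonal_matrix (\<lambda>i. cosh (2 * \<theta> i))) (diagonal_matrix (\<lambda>i. sinh (2 * \<theta> i)))"
    by (simp add: hyperbolic_matrix_def Let_def exchange_matrix_def block_matrix_mult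
        transpose_block_matrix diagonal_matrix_mult diagonal_matrix_add block_matrix_eq_iff double)
  have "H ** exchange_matrix ** transpose H = block_matrix O1 0 0 O2 **
      (hyperbolic_matrix \<theta> ** exchange_matrix ** transpose (hyperbolic_matrix \<theta>)) **
      transpose (block_matrix O1 0 0 O2)"
    by (simp add: H_def matrix_transpose_mul matrix_mul_assoc)
  then show ?thesis
    unfolding hyp by (simp add: block_matrix_mult transpose_block_matrix)
qed

lemma block_diagonal_hyperbolic_indefinite_orthogonal:
  assumes "orthogonal_matrix O1" "orthogonal_matrix O2"
  shows "block_matrix O1 0 0 O2 ** hyperbolic_matrix \<theta> \<in> indefinite_orthogonal_group"
proof -
  let ?K = "block_matrix O1 0 0 O2" and ?H = "hyperbolic_matrix \<theta>"
  have K: "transpose ?K ** signature_matrix ** ?K = signature_matrix"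
    using assms by (simp add: signature_matrix_def block_matrix_mult transpose_block_matrix
        orthogonal_matrix_def)
  have H: "transpose ?H ** signature_matrix ** ?H = signature_matrix"
    by (simp add: hyperbolic_matrix_def Let_def signature_matrix_def block_matrix_mult
        transpose_block_matrix diagonal_matrix_mult diagonal_matrix_add block_matrix_eq_iff)
      (simp add: diagonal_matrix_def mat_def vec_eq_iff cosh_square_eq
        flip: power2_eq_square)
  have "transpose (?K ** ?H) ** signature_matrix ** (?K ** ?H)
      = transpose ?H ** (transpose ?K ** signature_matrix ** ?K) ** ?H"
    by (simp add: matrix_transpose_mul matrix_mul_assoc)
  then show ?thesis by (simp add: K H indefinite_orthogonal_group_def)
qed

section \<open>Uniqueness of the hyperbolic parameters\<close>

text \<open>The factor \<open>realify V\<close> fixes the exchange form and so drops out.\<close>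

lemma is_factorization_exchange:
  assumes "is_factorization G O1 O2 \<theta> V"
  shows "G ** exchange_matrix ** transpose G =
    (block_matrix O1 0 0 O2 ** hyperbolic_matrix \<theta>) ** exchange_matrix **
      transpose (block_matrix O1 0 0 O2 ** hyperbolic_matrix \<theta>)" (is "_ = ?H ** _ ** _")
proof -
  have G: "G = ?H ** realify V" and V: "complex_orthogonal_matrix V"
    using assms unfolding is_factorization_def by blast+
  have "G ** exchange_matrix ** transpose G =
      ?H ** (realify V ** exchange_matrix ** transpose (realify V)) ** transpose ?H"
    unfolding G by (simp add: matrix_transpose_mul matrix_mul_assoc)
  then show ?thesis
    by (simp only: complex_orthogonal_realify_exchange[OF V])
qed

lemma is_factorization_unique:
  assumes "is_factorization G O1 O2 \<theta> V" and "is_factorization G O1' O2' \<phi> V'"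
  shows "equal_up_to_order_and_signs \<theta> \<phi>"
proof -
  have eq: "O1 ** diagonal_matrix (\<lambda>i. sinh (2 * \<theta> i)) ** transpose O1 =
      O1' ** diagonal_matrix (\<lambda>i. sinh (2 * \<phi> i)) ** transpose O1'"
    using trans[OF is_factorization_exchange[OF assms(1), symmetric]
        is_factorization_exchange[OF assms(2)]]
    unfolding block_diagonal_hyperbolic_exchange block_matrix_eq_iff by blast
  have orth: "orthogonal_matrix O1" "orthogonal_matrix O1'"
    using assms unfolding is_factorization_def by blast+
  obtain p where "p permutes UNIV" "\<And>i. sinh (2 * \<phi> i) = sinh (2 * \<theta> (p i))"
    by (rule orthogonally_similar_diagonal_matrices[OF orth eq]) blast
  \<comment> \<open>Injectivity of \<open>sinh\<close> gives
    \<open>\<phi> i = \<theta> (p i)\<close>, the required relation with every sign equal to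
    1.\<close>
  then show ?thesis
    unfolding equal_up_to_order_and_signs_def
    by (intro exI[of _ p] exI[of _ "\<lambda>_. 1"]) auto
qed

section \<open>Existence of the factorization\<close>

lemma exchange_conjugate_decomposition:
  fixes G :: "real ^ ('n::finite + 'n) ^ ('n + 'n)"
  assumes G: "G \<in> indefinite_orthogonal_group"
  obtains O1 O2 \<theta> where "orthogonal_matrix O1" "orthogonal_matrix O2"
    "G ** exchange_matrix ** transpose G =
      (block_matrix O1 0 0 O2 ** hyperbolic_matrix \<theta>) ** exchange_matrix **
        transpose (block_matrix O1 0 0 O2 ** hyperbolic_matrix \<theta>)"
proof -
  define N where "N = G ** exchange_matrix ** transpose G"
  obtain A B B' D where N: "N = block_matrix A B B' D" by (rule block_matrix_cases)
  have "transpose N = N"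
    by (simp add: N_def matrix_transpose_mul matrix_mul_assoc)
  then have sym: "transpose A = A" "B' = transpose B"
    by (auto simp: N transpose_block_matrix block_matrix_eq_iff)
  have "N ** signature_matrix ** N =
      G ** (exchange_matrix ** (transpose G ** signature_matrix ** G) ** exchange_matrix) ** transpose G"
    by (simp add: N_def matrix_mul_assoc)
  also have "\<dots> = - (G ** signature_matrix ** transpose G)"
    using G by (simp add: indefinite_orthogonal_group_def exchange_signature_exchange)
  also have "\<dots> = - signature_matrix"
    using G by (simp add: indefinite_orthogonal_mult_signature_transpose)
  \<comment> \<open>These are the two upper blocks of
    \<open>N ** signature_matrix ** N = - signature_matrix\<close>.\<close>
  finally have eqs: "B ** transpose B = mat 1 + A ** A" "A ** B = B ** D"
    by (auto simp: N sym signature_matrix_def block_matrix_mult minus_block_matrix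
        block_matrix_eq_iff algebra_simps)
  obtain P s where P: "orthogonal_matrix P" and A: "A = P ** diagonal_matrix s ** transpose P"
    using symmetric_matrix_orthogonally_diagonalizable[OF sym(1)] by metis
  have PP: "transpose P ** P = mat 1" "P ** transpose P = mat 1"
    using P by (auto simp: orthogonal_matrix_def)
  \<comment> \<open>Every real eigenvalue is a hyperbolic sine, so this choice solves
    \<open>s i = sinh (2 * \<theta> i)\<close>.\<close>
  define \<theta> where "\<theta> i = arsinh (s i) / 2" for i
  have s: "s = (\<lambda>i. sinh (2 * \<theta> i))" by (simp add: \<theta>_def)
  define S c ci where "S = diagonal_matrix s" and "c = diagonal_matrix (\<lambda>i. cosh (2 * \<theta> i))"
    and "ci = diagonal_matrix (\<lambda>i. 1 / cosh (2 * \<theta> i))"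
  have cci: "c ** ci = mat 1" "ci ** c = mat 1"
    by (simp_all add: c_def ci_def diagonal_matrix_mult diagonal_matrix_one)
  have cS: "c ** S = S ** c"
    by (simp add: c_def S_def diagonal_matrix_mult mult.commute)
  have cc: "mat 1 + S ** S = c ** c"
    by (simp add: c_def S_def s diagonal_matrix_mult diagonal_matrix_add cosh_square_eq add.commute
        flip: diagonal_matrix_one power2_eq_square)
  have tci: "transpose ci = ci" by (simp add: ci_def)
  \<comment> \<open>Forced by the desired equation \<open>B = P ** c ** transpose Q\<close>, since
    \<open>c\<close> is invertible with inverse \<open>ci\<close>. Orthogonality of \<open>Q\<close>
    amounts to \<open>B ** transpose B = P ** (c ** c) ** transpose P\<close>.\<close>
  define Q where "Q = transpose B ** P ** ci"
  have tQ: "transpose Q = ci ** transpose P ** B"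
    by (simp add: Q_def matrix_transpose_mul tci matrix_mul_assoc)
  have tPA: "transpose P ** A = S ** transpose P"
    unfolding A S_def using PP by (simp add: matrix_mul_assoc)
  have "B ** transpose B = P ** (c ** c) ** transpose P"
  proof -
    have "A ** A = P ** (S ** S) ** transpose P"
      by (metis A S_def tPA matrix_mul_assoc)
    then show ?thesis
      unfolding eqs(1) cc[symmetric]
      by (simp add: matrix_add_ldistrib matrix_mult_add_left PP)
  qed
  note BB = this
  note cancel = PP cci PP[THEN matrix_mult_cancel_left] cci[THEN matrix_mult_cancel_left]
  have "transpose Q ** Q = ci ** transpose P ** (B ** transpose B) ** P ** ci"
    unfolding tQ by (simp add: Q_def matrix_mul_assoc)
  also have "\<dots> = mat 1"
    unfolding BB by (simp add: cancel flip: matrix_mul_assoc)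
  finally have Q: "orthogonal_matrix Q" by (simp add: orthogonal_matrix)
  then have QQ: "Q ** transpose Q = mat 1" by (simp add: orthogonal_matrix_def)
  have B: "B = P ** c ** transpose Q"
    unfolding tQ by (simp add: cancel flip: matrix_mul_assoc)
  \<comment> \<open>The lower right block is not free: \<open>A ** B = B ** D\<close> with
    \<open>B\<close> invertible determines it.\<close>
  have "transpose Q ** D = ci ** transpose P ** (A ** B)"
    unfolding tQ eqs(2) by (simp add: matrix_mul_assoc)
  also have "\<dots> = ci ** (S ** c) ** transpose Q"
    by (subst B) (simp add: A cancel flip: matrix_mul_assoc S_def)
  also have "\<dots> = S ** transpose Q"
    unfolding cS[symmetric] by (simp add: cancel flip: matrix_mul_assoc)
  finally have D: "D = Q ** S ** transpose Q"
    using QQ by (metis matrix_mul_assoc matrix_mul_lid)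
  have "transpose B = Q ** c ** transpose P"
    by (simp add: B matrix_transpose_mul c_def matrix_mul_assoc)
  then have "N = (block_matrix P 0 0 Q ** hyperbolic_matrix \<theta>) ** exchange_matrix **
      transpose (block_matrix P 0 0 Q ** hyperbolic_matrix \<theta>)"
    unfolding block_diagonal_hyperbolic_exchange N sym(2) using A B D
    by (simp add: S_def c_def s)
  with P Q show ?thesis using that unfolding N_def by blast
qed

lemma is_factorization_exists:
  fixes G :: "real ^ ('n::finite + 'n) ^ ('n + 'n)"
  assumes G: "G \<in> indefinite_orthogonal_group"
  obtains O1 O2 \<theta> V where "is_factorization G O1 O2 \<theta> V"
proof -
  let ?C = "signature_matrix :: real ^ ('n + 'n) ^ ('n + 'n)"
  let ?E = "exchange_matrix :: real ^ ('n + 'n) ^ ('n + 'n)"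
  obtain O1 O2 \<theta> where orth: "orthogonal_matrix O1" "orthogonal_matrix O2"
    and eq: "G ** ?E ** transpose G =
      (block_matrix O1 0 0 O2 ** hyperbolic_matrix \<theta>) ** ?E **
        transpose (block_matrix O1 0 0 O2 ** hyperbolic_matrix \<theta>)"
    using exchange_conjugate_decomposition[OF G] by metis
  define H where "H = block_matrix O1 0 0 O2 ** hyperbolic_matrix \<theta>"
  have "H \<in> indefinite_orthogonal_group"
    unfolding H_def using orth by (rule block_diagonal_hyperbolic_indefinite_orthogonal)
  then have H: "transpose H ** ?C ** H = ?C" "H ** ?C ** transpose H = ?C"
    by (simp_all add: indefinite_orthogonal_mult_signature_transpose)
      (simp add: indefinite_orthogonal_group_def)
  have G': "transpose G ** ?C ** G = ?C" using G by (simp add: indefinite_orthogonal_group_def)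
  note CC = signature_matrix_mult_self
  \<comment> \<open>The factor in front of \<open>G\<close> is the inverse of \<open>H\<close>,
    because \<open>H\<close> preserves the signature form.\<close>
  define X where "X = ?C ** transpose H ** ?C ** G"
  have tX: "transpose X = transpose G ** ?C ** H ** ?C"
    by (simp add: X_def matrix_transpose_mul matrix_mul_assoc)
  have "H ** X = H ** ?C ** transpose H ** ?C ** G"
    by (simp add: X_def matrix_mul_assoc)
  then have HX: "G = H ** X" by (simp add: H CC)
  have "transpose X ** ?C ** X = transpose G ** (?C ** (H ** (?C ** ?C ** ?C) ** transpose H) ** ?C) ** G"
    unfolding tX by (simp add: X_def matrix_mul_assoc)
  then have X: "transpose X ** ?C ** X = ?C" by (simp add: CC H G')
  have "X ** ?E ** transpose X =
      ?C ** transpose H ** ?C ** (G ** ?E ** transpose G) ** ?C ** H ** ?C"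
    unfolding tX by (simp add: X_def matrix_mul_assoc)
  also have "\<dots> = ?C ** (transpose H ** ?C ** H) ** ?E ** (transpose H ** ?C ** H) ** ?C"
    unfolding eq H_def[symmetric] by (simp add: matrix_mul_assoc)
  also have "\<dots> = (?C ** ?C) ** ?E ** (?C ** ?C)"
    unfolding H by (simp add: matrix_mul_assoc)
  finally have "X ** ?E ** transpose X = ?E" by (simp add: CC)
  \<comment> \<open>Replace the signature matrix on the left by
    \<open>transpose X ** ?C ** X\<close> and then contract \<open>X ** ?E ** transpose X\<close> to
    \<open>?E\<close>.\<close>
  then have "X ** (?E ** ?C) = (?E ** ?C) ** X"
    using X by (metis matrix_mul_assoc)
  moreover have "X \<in> indefinite_orthogonal_group"
    using X by (simp add: indefinite_orthogonal_group_def)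
  ultimately obtain V where "complex_orthogonal_matrix V" "X = realify V"
    using indefinite_orthogonal_realifyE by metis
  then have "is_factorization G O1 O2 \<theta> V"
    using orth HX by (simp add: is_factorization_def H_def)
  then show ?thesis using that by blast
qed

theorem theorem7p8:
  fixes G :: "real ^ ('n::finite + 'n) ^ ('n + 'n)"
  assumes "G \<in> indefinite_orthogonal_group"
  shows "\<exists>O1 O2 V \<theta>. is_factorization G O1 O2 \<theta> V \<and>
           (\<forall>O1' O2' V' \<phi>. is_factorization G O1' O2' \<phi> V' \<longrightarrow>
              equal_up_to_order_and_signs \<theta> \<phi>)"
proof -
  obtain O1 O2 \<theta> V where fact: "is_factorization G O1 O2 \<theta> V"
    using assms by (rule is_factorization_exists)
  then show ?thesis using is_factorization_unique by blast
qed

end
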